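(* Let $X$ be a reflexive real Banach space with dual $X^*$ and duality product $\langle\cdot,\cdot\rangle$. Let $h:X\times X^*\to\overline{\mathbb{R}}$ be a convex lower semicontinuous function such that $$\forall (x,v)\in X\times X^*,\qquad h(x,v)\geq \langle x,v\rangle \quad\text{and}\quad h^*(v,x)\geq \langle x,v\rangle .$$ Define $$T=\{(x,v)\in X\times X^* \;|\; h(x,v)=\langle x,v\rangle\}.$$ Then $T$ (viewed as the graph of a multivalued operator $X\rightrightarrows X^*$) is maximal monotone, and both $h\in\mathcal{H}(T)$ and $\mathcal{J}(h)\in\mathcal{H}(T)$.
   Context: $\overline{\mathbb{R}}=\mathbb{R}\cup\{-\infty,+\infty\}$. For $x\in X$, $v\in X^*$, $\langle x,v\rangle$ denotes the value of $v$ at $x$. A multivalued operator $T:X\rightrightarrows X^*$ is identified with its graph $\{(x,v)\in X\times X^*\;|\;v\in T(x)\}$. It is monotone if $\langle x_1-x_2,v_1-v_2\rangle\geq 0$ for all $(x_1,v_1),(x_2,v_2)\in T$; it is maximal monotone if it is monotone and its graph is not properly contained in the graph of any other monotone operator $T':X\rightrightarrows X^*$. For $h:X\times X^*\to\overline{\mathbb{R}}$, the conjugate $h^*$ is defined on $X^*\times X^{**}$; using the natural injection of $X$ into $X^{**}$, for $(x,v)\in X\times X^*$, $$h^*(v,x)=\sup\{\langle y,v\rangle+\langle x,u\rangle-h(y,u)\;|\;(y,u)\in X\times X^*\}.$$ The function $\mathcal{J}(h):X\times X^*\to\overline{\mathbb{R}}$ is defined by $\mathcal{J}(h)(x,v)=h^*(v,x)$.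 A convex function is called closed if it is lower semicontinuous (with respect to the norm topology). For a maximal monotone operator $T:X\rightrightarrows X^*$, $\mathcal{H}(T)$ is the set of all closed convex functions $g:X\times X^*\to\overline{\mathbb{R}}$ such that $g(x,v)\geq\langle x,v\rangle$ for all $(x,v)\in X\times X^*$, and $g(x,v)=\langle x,v\rangle$ whenever $(x,v)\in T$. *)

theory Defs
  imports "HOL-Analysis.Analysis"
begin

type_synonym 'a dual = "'a \<Rightarrow>\<^sub>L real"

definition bidual_embedding :: "'a::real_normed_vector \<Rightarrow> 'a dual dual" where
  "bidual_embedding x = Blinfun (\<lambda>v. blinfun_apply v x)"

lemma bidual_embedding_apply [simp]:
  "blinfun_apply (bidual_embedding x) v = blinfun_apply v x"
  unfolding bidual_embedding_def
  by (simp add: bounded_linear_Blinfun_apply)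

definition reflexive_space :: "'a::real_normed_vector itself \<Rightarrow> bool" where
  "reflexive_space _ \<longleftrightarrow> surj (bidual_embedding :: 'a \<Rightarrow> 'a dual dual)"

text \<open>Convexity of an extended-real-valued function is convexity of its epigraph, which avoids
  any convention for the sum of the two infinities.\<close>

definition ereal_convex :: "('b::real_vector \<Rightarrow> ereal) \<Rightarrow> bool" where
  "ereal_convex f \<longleftrightarrow> convex {(z, r :: real). f z \<le> ereal r}"

definition lower_semicontinuous :: "('b::topological_space \<Rightarrow> ereal) \<Rightarrow> bool" where
  "lower_semicontinuous f \<longleftrightarrow> (\<forall>z. \<forall>a < f z. \<forall>\<^sub>F w in nhds z. a < f w)"

text \<open>Multivalued operators from a space to its dual are identified with their graphs.\<close>

definition monotone_operator :: "('a::real_normed_vector \<times> 'a dual) set \<Rightarrow> bool" where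
  "monotone_operator T \<longleftrightarrow>
    (\<forall>(x1, v1) \<in> T. \<forall>(x2, v2) \<in> T. blinfun_apply (v1 - v2) (x1 - x2) \<ge> 0)"

definition maximal_monotone :: "('a::real_normed_vector \<times> 'a dual) set \<Rightarrow> bool" where
  "maximal_monotone T \<longleftrightarrow>
    monotone_operator T \<and> \<not> (\<exists>T'. monotone_operator T' \<and> T \<subset> T')"

definition conjugate ::
    "('a::real_normed_vector \<times> 'a dual \<Rightarrow> ereal) \<Rightarrow> 'a dual \<times> 'a dual dual \<Rightarrow> ereal" where
  "conjugate h = (\<lambda>(v, \<xi>).
    SUP (y, u) \<in> UNIV. ereal (blinfun_apply v y + blinfun_apply \<xi> u) - h (y, u))"

definition conjugate_swap ::
    "('a::real_normed_vector \<times> 'a dual \<Rightarrow> ereal) \<Rightarrow> 'a \<times> 'a dual \<Rightarrow> ereal"  (\<open>\<J>\<close>) where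
  "\<J> h = (\<lambda>(x, v). conjugate h (v, bidual_embedding x))"

definition representing_functions ::
    "('a::real_normed_vector \<times> 'a dual) set \<Rightarrow> ('a \<times> 'a dual \<Rightarrow> ereal) set"  (\<open>\<H>\<close>) where
  "\<H> T = {g. ereal_convex g \<and> lower_semicontinuous g \<and>
    (\<forall>x v. g (x, v) \<ge> ereal (blinfun_apply v x)) \<and>
    (\<forall>(x, v) \<in> T. g (x, v) = ereal (blinfun_apply v x))}"

end

theory Submission
  imports Defs
begin

text \<open>Write \<open>\<pi> (x, v) = v x\<close>. Where a convex function above \<open>\<pi>\<close> touches it, the derivative of \<open>\<pi>\<close> is a
  subgradient; hence \<open>{h = \<pi>}\<close> is monotone and contained in \<open>{\<J> h = \<pi>}\<close>, and by Fenchel--Moreau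
  (using reflexivity) the two sets agree. For maximality, let \<open>z0\<close> be monotonically related to \<open>T\<close>.
  Since \<open>\<pi> + \<parallel>\<cdot>\<parallel>\<^sup>2 / 2 \<ge> 0\<close>, Fenchel duality applied to \<open>h\<close> translated by \<open>z0\<close> and to \<open>\<parallel>\<cdot>\<parallel>\<^sup>2 / 2\<close> gives a
  dual solution \<open>z1\<close>, which satisfies \<open>\<J> h z1 = \<pi> z1\<close>, so \<open>z1\<close> lies in \<open>T\<close> and \<open>\<pi> (z1 - z0) \<ge> 0\<close>; optimality
  then forces \<open>z1 = z0\<close>. Only dual attainment is used, so neither weak compactness nor
  renorming is needed. All separation arguments rest on Hahn--Banach, obtained by taking a minimal
  sublinear functional.\<close>

section \<open>Sublinear functionals and the Hahn--Banach theorem\<close>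

definition sublinear :: "('b::real_vector \<Rightarrow> real) \<Rightarrow> bool" where
  "sublinear p \<longleftrightarrow> (\<forall>x y. p (x + y) \<le> p x + p y) \<and> (\<forall>s>0. \<forall>x. p (s *\<^sub>R x) = s * p x)"

lemma sublinearI:
  assumes "\<And>x y. p (x + y) \<le> p x + p y" "\<And>s x. s > 0 \<Longrightarrow> p (s *\<^sub>R x) = s * p x"
  shows "sublinear p"
  using assms by (auto simp: sublinear_def)

lemma sublinear_add: "sublinear p \<Longrightarrow> p (x + y) \<le> p x + p y"
  by (simp add: sublinear_def)

lemma sublinear_scale: "sublinear p \<Longrightarrow> s > 0 \<Longrightarrow> p (s *\<^sub>R x) = s * p x"
  by (simp add: sublinear_def)

lemma sublinear_0: "sublinear p \<Longrightarrow> p 0 = 0"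
  using sublinear_scale[of p 2 0] by simp

lemma sublinear_minus: "sublinear p \<Longrightarrow> - p (- x) \<le> p x"
  using sublinear_add[of p x "-x"] sublinear_0[of p] by simp

lemma sublinearI_le:
  assumes add: "\<And>x y. p (x + y) \<le> p x + p y" and le: "\<And>s x. s > 0 \<Longrightarrow> p (s *\<^sub>R x) \<le> s * p x"
  shows "sublinear p"
proof (rule sublinearI[OF add])
  fix s :: real and x assume s: "s > 0"
  have "p (inverse s *\<^sub>R s *\<^sub>R x) \<le> inverse s * p (s *\<^sub>R x)"
    using le[of "inverse s" "s *\<^sub>R x"] s by simp
  then have "s * p x \<le> p (s *\<^sub>R x)"
    using s by (simp add: field_simps)
  then show "p (s *\<^sub>R x) = s * p x"
    using le[OF s, of x] by simp
qed

text \<open>The pointwise infimum works: it is finite because each member is at least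
  \<open>- q (- x)\<close> at \<open>x\<close>, and subadditive because the smaller of two members
  of a chain lies below both.\<close>

lemma sublinear_chain_lower_bound:
  fixes C :: "('b::real_vector \<Rightarrow> real) set"
  assumes sub: "\<And>p. p \<in> C \<Longrightarrow> sublinear p" and le: "\<And>p. p \<in> C \<Longrightarrow> p \<le> q" and ne: "C \<noteq> {}"
    and chain: "\<And>p p'. p \<in> C \<Longrightarrow> p' \<in> C \<Longrightarrow> p \<le> p' \<or> p' \<le> p"
  shows "\<exists>m. sublinear m \<and> (\<forall>p\<in>C. m \<le> p)"
proof -
  define m where "m x = (INF p\<in>C. p x)" for x
  have bdd: "bdd_below ((\<lambda>p. p x) ` C)" for x
  proof (rule bdd_belowI2)
    fix p assume p: "p \<in> C"
    show "- q (- x) \<le> p x"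
      using sublinear_minus[OF sub[OF p], of x] le_funD[OF le[OF p], of "- x"] by linarith
  qed
  have lower: "m x \<le> p x" if "p \<in> C" for p x
    unfolding m_def using that bdd by (intro cINF_lower)
  have "sublinear m"
  proof (rule sublinearI_le)
    fix x y
    have "m (x + y) - p' y \<le> m x" if p': "p' \<in> C" for p'
      unfolding m_def[of x]
    proof (rule cINF_greatest[OF ne])
      fix p assume p: "p \<in> C"
      from chain[OF p p'] obtain p'' where p'': "p'' \<in> C" "p'' \<le> p" "p'' \<le> p'"
        using p p' by auto
      have "m (x + y) \<le> p'' x + p'' y"
        using lower[OF p''(1), of "x + y"] sublinear_add[OF sub[OF p''(1)], of x y] by linarith
      then show "m (x + y) - p' y \<le> p x"
        using le_funD[OF p''(2), of x] le_funD[OF p''(3), of y] by linarith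
    qed
    then have "m (x + y) - m x \<le> p' y" if "p' \<in> C" for p'
      using that by (smt (verit))
    then have "m (x + y) - m x \<le> m y"
      unfolding m_def[of y] by (intro cINF_greatest[OF ne])
    then show "m (x + y) \<le> m x + m y" by linarith
  next
    fix s :: real and x assume s: "s > 0"
    have "m (s *\<^sub>R x) / s \<le> m x"
      unfolding m_def[of x]
    proof (rule cINF_greatest[OF ne])
      fix p assume p: "p \<in> C"
      show "m (s *\<^sub>R x) / s \<le> p x"
        using lower[OF p, of "s *\<^sub>R x"] sublinear_scale[OF sub[OF p] s, of x] s
        by (simp add: field_simps)
    qed
    then show "m (s *\<^sub>R x) \<le> s * m x" using s by (simp add: field_simps)
  qed
  with lower show ?thesis by (auto simp: le_fun_def)
qed

text \<open>For each direction \<open>a\<close>, \<open>inf {p (y + t a) - t p a | t \<ge> 0}\<close> is sublinear and below \<open>p\<close>, hence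
  equal to \<open>p\<close>; taking \<open>t = 1\<close> shows that \<open>p\<close> is additive.\<close>

lemma minimal_sublinear_linear:
  assumes p: "sublinear p" and min: "\<And>p'. sublinear p' \<Longrightarrow> p' \<le> p \<Longrightarrow> p' = p"
  shows "linear p"
proof -
  have add: "p (x + a) = p x + p a" for x a
  proof -
    define q where "q y = (INF t\<in>{0..}. p (y + t *\<^sub>R a) - t * p a)" for y
    have ta: "p (t *\<^sub>R a) = t * p a" if "t \<ge> 0" for t
      using that sublinear_scale[OF p, of t a] sublinear_0[OF p] by (cases "t = 0") auto
    have bdd: "bdd_below ((\<lambda>t. p (y + t *\<^sub>R a) - t * p a) ` {0..})" for y
    proof (rule bdd_belowI2)
      fix t :: real assume "t \<in> {0..}"
      then show "- p (- y) \<le> p (y + t *\<^sub>R a) - t * p a"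
        using sublinear_add[OF p, of "y + t *\<^sub>R a" "- y"] ta[of t] by simp
    qed
    have lower: "q y \<le> p (y + t *\<^sub>R a) - t * p a" if "t \<ge> 0" for y t
      unfolding q_def using bdd that by (intro cINF_lower) auto
    have "sublinear q"
    proof (rule sublinearI_le)
      fix y z
      have 1: "q (y + z) - (p (z + t *\<^sub>R a) - t * p a) \<le> q y" if t: "t \<ge> 0" for t
        unfolding q_def[of y]
      proof (rule cINF_greatest)
        fix s :: real assume s: "s \<in> {0..}"
        have "q (y + z) \<le> p ((y + z) + (s + t) *\<^sub>R a) - (s + t) * p a"
          using lower[of "s + t"] s t by simp
        moreover have "p ((y + z) + (s + t) *\<^sub>R a) \<le> p (y + s *\<^sub>R a) + p (z + t *\<^sub>R a)"
          using sublinear_add[OF p, of "y + s *\<^sub>R a" "z + t *\<^sub>R a"] by (simp add: algebra_simps)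
        ultimately show "q (y + z) - (p (z + t *\<^sub>R a) - t * p a) \<le> p (y + s *\<^sub>R a) - s * p a"
          by (simp add: algebra_simps)
      qed simp
      have "q (y + z) - q y \<le> q z"
        unfolding q_def[of z] by (rule cINF_greatest) (use 1 in \<open>auto simp: algebra_simps\<close>)
      then show "q (y + z) \<le> q y + q z" by simp
    next
      fix s :: real and y assume s: "s > 0"
      have "q (s *\<^sub>R y) / s \<le> q y"
        unfolding q_def[of y]
      proof (rule cINF_greatest)
        fix t :: real assume "t \<in> {0..}"
        then have "q (s *\<^sub>R y) \<le> p (s *\<^sub>R (y + t *\<^sub>R a)) - s * t * p a"
          using lower[of "s * t" "s *\<^sub>R y"] s by (simp add: algebra_simps)
        then show "q (s *\<^sub>R y) / s \<le> p (y + t *\<^sub>R a) - t * p a"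
          using sublinear_scale[OF p s, of "y + t *\<^sub>R a"] s by (simp add: field_simps)
      qed simp
      then show "q (s *\<^sub>R y) \<le> s * q y" using s by (simp add: field_simps)
    qed
    moreover have "q \<le> p"
      using lower[of 0] by (auto simp: le_fun_def)
    ultimately have "q = p" by (rule min)
    with lower[of 1 x] have "p x \<le> p (x + a) - p a" by simp
    with sublinear_add[OF p, of x a] show ?thesis by linarith
  qed
  have neg: "p (- x) = - p x" for x
    using add[of x "- x"] sublinear_0[OF p] by simp
  have "p (s *\<^sub>R x) = s * p x" for s x
  proof -
    consider "s > 0" | "s = 0" | "- s > 0" by linarith
    then show ?thesis
    proof cases
      case 3
      then show ?thesis using sublinear_scale[OF p 3, of x] neg[of "s *\<^sub>R x"] by simp
    qed (auto simp: sublinear_scale[OF p] sublinear_0[OF p])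
  qed
  with add show ?thesis by (intro linearI) auto
qed

text \<open>Zorn's lemma in the reversed order gives a minimal sublinear functional below
  \<open>q\<close>; minimality forces linearity.\<close>

theorem hahn_banach_sublinear:
  fixes q :: "'b::real_vector \<Rightarrow> real"
  assumes q: "sublinear q"
  obtains l where "linear l" "\<And>x. l x \<le> q x"
proof -
  define A where "A = {p. sublinear p \<and> p \<le> q}"
  have "\<exists>m\<in>A. \<forall>p\<in>A. m \<ge> p \<longrightarrow> p = m"
  proof (rule predicate_Zorn)
    show "partial_order_on A (relation_of (\<ge>) A)"
      by (rule partial_order_on_relation_ofI) auto
    fix C assume C: "C \<in> Chains (relation_of (\<ge>) A)"
    show "\<exists>m\<in>A. \<forall>p\<in>C. p \<ge> m"
    proof (cases "C = {}")
      case True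
      then show ?thesis using q by (auto simp: A_def)
    next
      case False
      have CA: "C \<subseteq> A" using C by (auto simp: Chains_def relation_of_def)
      have "\<exists>m. sublinear m \<and> (\<forall>p\<in>C. m \<le> p)"
      proof (rule sublinear_chain_lower_bound[OF _ _ False])
        show "p \<le> p' \<or> p' \<le> p" if "p \<in> C" "p' \<in> C" for p p'
          using C that by (auto simp: Chains_def relation_of_def)
      qed (use CA in \<open>auto simp: A_def\<close>)
      then obtain m where m: "sublinear m" "\<forall>p\<in>C. m \<le> p" by blast
      moreover have "m \<le> q" using m(2) False CA unfolding A_def by fastforce
      ultimately show ?thesis by (auto simp: A_def)
    qed
  qed
  then obtain m where m: "sublinear m" "m \<le> q" "\<And>p. p \<in> A \<Longrightarrow> p \<le> m \<Longrightarrow> p = m"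
    by (auto simp: A_def)
  have "linear m"
    by (rule minimal_sublinear_linear[OF m(1)]) (use m in \<open>auto simp: A_def intro: order_trans\<close>)
  then show thesis using that m(2) by (auto simp: le_fun_def)
qed

section \<open>Fenchel duality with an attained dual solution\<close>

text \<open>The value function \<open>q z = inf (f y + g (y - z))\<close> of the dual problem, with \<open>E\<close> the epigraph of
  \<open>f\<close>, is convex with \<open>q 0 \<ge> 0\<close>; the functional \<open>p\<close> below is the sublinear hull
  \<open>inf {q (t d) / t | t > 0}\<close>.\<close>

lemma convex_duality_linear:
  fixes E :: "('b::real_vector \<times> real) set" and g :: "'b \<Rightarrow> real"
  assumes E: "convex E" "E \<noteq> {}" and g: "convex_on UNIV g"
    and nonneg: "\<And>y r. (y, r) \<in> E \<Longrightarrow> r + g y \<ge> 0"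
  obtains l where "linear l" "\<And>y r w. (y, r) \<in> E \<Longrightarrow> l y - r \<le> l w + g w"
proof -
  define S where "S d = {(r + g (y - t *\<^sub>R d)) / t |t y r. t > 0 \<and> (y, r) \<in> E}" for d
  define p where "p d = Inf (S d)" for d
  obtain y0 r0 where E0: "(y0, r0) \<in> E" using E(2) by auto
  have SI: "(r + g (y - t *\<^sub>R d)) / t \<in> S d" if "t > 0" "(y, r) \<in> E" for t y r d
    using that by (auto simp: S_def)
  have ne: "S d \<noteq> {}" for d using SI[of 1, OF _ E0] by auto
  have S_add: "\<exists>c\<in>S (d + e). c \<le> a + b" if a: "a \<in> S d" and b: "b \<in> S e" for a b d e
  proof -
    obtain t y r where 1: "t > 0" "(y, r) \<in> E" "a = (r + g (y - t *\<^sub>R d)) / t"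
      using a unfolding S_def by blast
    obtain t' y' r' where 2: "t' > 0" "(y', r') \<in> E" "b = (r' + g (y' - t' *\<^sub>R e)) / t'"
      using b unfolding S_def by blast
    \<comment> \<open>The weights make \<open>k * t\<close> and \<open>j * t'\<close> equal, so that
      the combination of \<open>y - t *\<^sub>R d\<close> and \<open>y' - t' *\<^sub>R e\<close>
      moves along \<open>d + e\<close> with the single step \<open>s\<close>.\<close>
    define k where "k = t' / (t + t')"
    define j where "j = t / (t + t')"
    define s where "s = t * t' / (t + t')"
    have kj: "k \<ge> 0" "j \<ge> 0" "k + j = 1" "k * t = s" "j * t' = s" "s > 0" "k / s = 1 / t" "j / s = 1 / t'"
      using 1(1) 2(1) by (auto simp: k_def j_def s_def field_simps) (smt (verit) mult_pos_pos)+
    have in_E: "(k *\<^sub>R y + j *\<^sub>R y', k * r + j * r') \<in> E"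
      using convexD[OF E(1) 1(2) 2(2) kj(1-3)] by simp
    have "(k *\<^sub>R y + j *\<^sub>R y') - s *\<^sub>R (d + e)
        = k *\<^sub>R (y - t *\<^sub>R d) + j *\<^sub>R (y' - t' *\<^sub>R e)"
      by (simp add: algebra_simps kj(4,5))
    then have "g ((k *\<^sub>R y + j *\<^sub>R y') - s *\<^sub>R (d + e))
        \<le> k * g (y - t *\<^sub>R d) + j * g (y' - t' *\<^sub>R e)"
      using g kj(1-3) unfolding convex_on_def by simp
    then have "((k * r + j * r') + g ((k *\<^sub>R y + j *\<^sub>R y') - s *\<^sub>R (d + e))) / s
        \<le> (k * (r + g (y - t *\<^sub>R d)) + j * (r' + g (y' - t' *\<^sub>R e))) / s"
      using kj(6) by (intro divide_right_mono) (auto simp: algebra_simps)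
    also have "\<dots> = (k / s) * (r + g (y - t *\<^sub>R d)) + (j / s) * (r' + g (y' - t' *\<^sub>R e))"
      by (simp add: add_divide_distrib)
    also have "\<dots> = a + b" using 1(3) 2(3) kj(7,8) by simp
    finally show ?thesis using SI[OF kj(6) in_E] by blast
  qed
  have S_0: "c \<ge> 0" if "c \<in> S 0" for c
    using that nonneg by (auto simp: S_def)
  have bdd: "bdd_below (S d)" for d
  proof -
    obtain b where b: "b \<in> S (- d)" using ne by blast
    have "- b \<le> a" if "a \<in> S d" for a
      using S_add[OF that b] S_0 by fastforce
    then show ?thesis by (rule bdd_belowI)
  qed
  have lower: "p d \<le> a" if "a \<in> S d" for a d
    unfolding p_def using that bdd by (rule cInf_lower)
  have "sublinear p"
  proof (rule sublinearI_le)
    fix d e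
    have 1: "p (d + e) \<le> a + b" if "a \<in> S d" "b \<in> S e" for a b
      using S_add[OF that] lower by force
    have "p (d + e) - b \<le> p d" if "b \<in> S e" for b
      unfolding p_def[of d] by (rule cInf_greatest[OF ne]) (use 1 that in \<open>force simp: algebra_simps\<close>)
    then have "p (d + e) - p d \<le> b" if "b \<in> S e" for b
      using that by (smt (verit))
    then have "p (d + e) - p d \<le> p e"
      unfolding p_def[of e] by (rule cInf_greatest[OF ne])
    then show "p (d + e) \<le> p d + p e" by simp
  next
    fix s :: real and d assume s: "s > 0"
    have "p (s *\<^sub>R d) / s \<le> p d"
      unfolding p_def[of d]
    proof (rule cInf_greatest[OF ne])
      fix a assume "a \<in> S d"
      then obtain t y r where t: "t > 0" "(y, r) \<in> E" "a = (r + g (y - t *\<^sub>R d)) / t"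
        unfolding S_def by blast
      have "s * a \<in> S (s *\<^sub>R d)"
        using SI[of "t / s" y r "s *\<^sub>R d"] s t by (simp add: mult.commute)
      then show "p (s *\<^sub>R d) / s \<le> a"
        using lower s by (simp add: field_simps)
    qed
    then show "p (s *\<^sub>R d) \<le> s * p d" using s by (simp add: field_simps)
  qed
  then obtain l where l: "linear l" "\<And>d. l d \<le> p d" by (rule hahn_banach_sublinear) blast
  show thesis
  proof
    fix y r w assume "(y, r) \<in> E"
    \<comment> \<open>The step \<open>t = 1\<close> in the direction \<open>y - w\<close> moves
      \<open>y\<close> to \<open>w\<close>.\<close>
    then have "p (y - w) \<le> r + g w"
      using lower[OF SI[of 1 y r "y - w"]] by simp
    then show "l y - r \<le> l w + g w"
      using l(2)[of "y - w"] linear_diff[OF l(1), of y w] by linarith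
  qed (fact l)
qed

text \<open>The bound on \<open>g\<close> over the unit ball makes the dual solution continuous: a
  fixed point of \<open>E\<close> in the duality inequality gives \<open>- l w \<le> K\<close>
  there, and \<open>- w\<close> gives the other sign.\<close>

theorem convex_duality:
  fixes E :: "('b::real_normed_vector \<times> real) set" and g :: "'b \<Rightarrow> real"
  assumes E: "convex E" "E \<noteq> {}" and g: "convex_on UNIV g"
    and nonneg: "\<And>y r. (y, r) \<in> E \<Longrightarrow> r + g y \<ge> 0"
    and bound: "\<And>w. norm w \<le> 1 \<Longrightarrow> g w \<le> B"
  obtains l :: "'b \<Rightarrow>\<^sub>L real" where "\<And>y r w. (y, r) \<in> E \<Longrightarrow> l y - r \<le> l w + g w"
proof -
  obtain l where l: "linear l" and le: "\<And>y r w. (y, r) \<in> E \<Longrightarrow> l y - r \<le> l w + g w"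
    by (rule convex_duality_linear[OF E g nonneg]) blast+
  obtain y0 r0 where E0: "(y0, r0) \<in> E" using E(2) by auto
  define K where "K = B + r0 - l y0"
  have K: "- l w \<le> K" if "norm w \<le> 1" for w
    using le[OF E0, of w] bound[OF that] by (simp add: K_def)
  have "\<bar>l w\<bar> \<le> norm w * K" for w
  proof (cases "w = 0")
    case True
    then show ?thesis using linear_0[OF l] by simp
  next
    case False
    have "- (l w / norm w) \<le> K"
      using K[of "w /\<^sub>R norm w"] False linear_scale[OF l, of "inverse (norm w)" w]
      by (simp add: divide_inverse mult.commute)
    moreover have "l w / norm w \<le> K"
      using K[of "- (w /\<^sub>R norm w)"] False linear_scale[OF l, of "inverse (norm w)" w]
        linear_neg[OF l, of "w /\<^sub>R norm w"]
      by (simp add: divide_inverse mult.commute)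
    ultimately show ?thesis using False by (simp add: field_simps abs_le_iff)
  qed
  then have "bounded_linear l"
    using l by (intro bounded_linear_intro[of l K])
      (auto simp: linear_add linear_scale)
  then have "blinfun_apply (Blinfun l) = l" by (rule bounded_linear_Blinfun_apply)
  then show thesis using that[of "Blinfun l"] le by simp
qed

section \<open>Norming functionals and affine minorants\<close>

lemma convex_on_square_dist: "convex_on UNIV (\<lambda>z :: 'b::real_normed_vector. (dist a z)\<^sup>2)"
proof (rule convex_onI)
  fix t :: real and x y :: 'b assume t: "0 < t" "t < 1"
  have "dist a ((1 - t) *\<^sub>R x + t *\<^sub>R y) \<le> (1 - t) * dist a x + t * dist a y"
    using t by (intro convex_onD[OF convex_on_dist[of UNIV a]]) auto
  then have "(dist a ((1 - t) *\<^sub>R x + t *\<^sub>R y))\<^sup>2 \<le> ((1 - t) * dist a x + t * dist a y)\<^sup>2"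
    by (rule power_mono) simp
  also have "\<dots> \<le> (1 - t) * (dist a x)\<^sup>2 + t * (dist a y)\<^sup>2"
    using convex_onD[OF convex_power2, of t "dist a x" "dist a y"] t by simp
  finally show "(dist a ((1 - t) *\<^sub>R x + t *\<^sub>R y))\<^sup>2 \<le> (1 - t) * (dist a x)\<^sup>2 + t * (dist a y)\<^sup>2" .
qed simp

text \<open>Duality between the single point \<open>(a, - norm a)\<close> and the norm:
  \<open>l w + norm w\<close> is positively homogeneous and bounded below, hence nonnegative, so
  \<open>norm l \<le> 1\<close>; then \<open>l a = - norm a\<close>, and \<open>- l\<close> is the
  functional.\<close>

lemma norming_functional:
  fixes a :: "'b::real_normed_vector"
  obtains l :: "'b dual" where "norm l \<le> 1" "l a = norm a"
proof -
  obtain l :: "'b dual" where "\<And>y r w. (y, r) \<in> {(a, - norm a)} \<Longrightarrow> l y - r \<le> l w + norm w"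
  proof (rule convex_duality[of "{(a, - norm a)}" norm 1])
    show "convex_on UNIV (norm :: 'b \<Rightarrow> real)"
      using convex_on_dist[of UNIV "0 :: 'b"] by simp
  qed auto
  then have l: "l a + norm a \<le> l w + norm w" for w by simp
  have lower: "0 \<le> l w + norm w" for w
  proof (rule ccontr)
    define c where "c = l w + norm w"
    define t where "t = - (\<bar>l a + norm a\<bar> + 1) / c"
    assume "\<not> ?thesis"
    then have neg: "c < 0" by (simp add: c_def)
    then have "t \<ge> 0" by (simp add: t_def divide_nonpos_neg)
    then have "l a + norm a \<le> t * c"
      using l[of "t *\<^sub>R w"] by (simp add: blinfun.scaleR_right c_def distrib_left)
    also have "\<dots> = - (\<bar>l a + norm a\<bar> + 1)"
      using neg by (simp add: t_def)
    finally show False by linarith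
  qed
  have "norm l \<le> 1"
  proof (rule norm_blinfun_bound)
    show "norm (l w) \<le> 1 * norm w" for w
      using lower[of w] lower[of "- w"] by (simp add: blinfun.minus_right abs_le_iff)
  qed simp
  moreover have "l a = - norm a"
    using l[of 0] lower[of a] by simp
  ultimately show thesis using that[of "- l"] by (simp add: blinfun.minus_left)
qed

lemma dual_separates_points:
  fixes a :: "'b::real_normed_vector"
  assumes "\<And>v :: 'b dual. v a = 0"
  shows "a = 0"
  by (rule norming_functional[of a]) (simp add: assms)

text \<open>Duality against the cone \<open>M * dist z0 z - a\<close>: lower semicontinuity puts \<open>f\<close> above its negative near
  \<open>z0\<close>, and the affine minorant does so far from \<open>z0\<close> once \<open>M\<close> is large.\<close>

lemma fenchel_moreau:
  fixes f :: "'b::real_normed_vector \<Rightarrow> ereal" and A :: "'b \<Rightarrow>\<^sub>L real"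
  assumes f: "ereal_convex f" "lower_semicontinuous f" "f y0 < \<infinity>"
    and minorant: "\<And>z. ereal (A z + c) \<le> f z" and a: "ereal a < f z0"
  obtains l :: "'b \<Rightarrow>\<^sub>L real" where "\<And>z. ereal (l (z - z0) + a) \<le> f z"
proof -
  obtain \<delta> where \<delta>: "\<delta> > 0" "\<And>z. dist z z0 < \<delta> \<Longrightarrow> ereal a < f z"
    using f(2) a unfolding lower_semicontinuous_def eventually_nhds_metric by blast
  \<comment> \<open>The term \<open>norm A\<close> controls the variation of the minorant; the
    quotient makes up its gap to \<open>a\<close> at \<open>z0\<close> over any distance of at least
    \<open>\<delta>\<close>.\<close>
  define M where "M = norm A + \<bar>a - (A z0 + c)\<bar> / \<delta>"
  have M: "M \<ge> 0" using \<delta>(1) by (simp add: M_def)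
  have below: "a - M * dist z0 z \<le> r" if r: "f z \<le> ereal r" for z r
  proof (cases "dist z z0 < \<delta>")
    case True
    then have "ereal a < ereal r" using \<delta>(2) r by (metis order_less_le_trans)
    moreover have "0 \<le> M * dist z0 z" using M by simp
    ultimately show ?thesis by simp
  next
    case False
    then have "\<bar>a - (A z0 + c)\<bar> * 1 \<le> \<bar>a - (A z0 + c)\<bar> * (dist z0 z / \<delta>)"
      using \<delta>(1) by (intro mult_left_mono) (auto simp: dist_commute)
    moreover have "A (z0 - z) \<le> norm A * dist z0 z"
      using norm_blinfun[of A "z0 - z"] by (simp add: dist_norm)
    ultimately have "a - M * dist z0 z \<le> A z + c"
      by (simp add: M_def blinfun.diff_right algebra_simps)
    also have "\<dots> \<le> r" using minorant[of z] r by (metis ereal_less_eq(3) order_trans)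
    finally show ?thesis .
  qed
  obtain r0 where r0: "f y0 \<le> ereal r0"
  proof (cases "f y0")
    case PInf
    then show ?thesis using f(3) by simp
  qed (auto intro: that)
  obtain l :: "'b \<Rightarrow>\<^sub>L real"
    where l: "\<And>y r w. (y, r) \<in> {(z, r). f z \<le> ereal r} \<Longrightarrow> l y - r \<le> l w + (M * dist z0 w + - a)"
  proof (rule convex_duality[of "{(z, r). f z \<le> ereal r}" "\<lambda>z. M * dist z0 z + - a"])
    show "convex {(z, r). f z \<le> ereal r}" using f(1) by (simp add: ereal_convex_def)
    show "convex_on UNIV (\<lambda>z. M * dist z0 z + - a)"
      using M by (intro convex_on_add convex_on_cmul convex_on_dist) (auto simp: convex_on_const)
    show "M * dist z0 w + - a \<le> M * (norm z0 + 1) + - a" if "norm w \<le> 1" for w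
      using M that norm_triangle_ineq4[of z0 w] by (intro add_right_mono mult_left_mono) (auto simp: dist_norm)
  qed (use r0 below in force)+
  show thesis
  proof
    fix z
    \<comment> \<open>At the apex \<open>w = z0\<close> the cone term reduces to
      \<open>- a\<close>.\<close>
    have *: "l (z - z0) + a \<le> r" if "f z \<le> ereal r" for r
      using l[of z r z0] that by (simp add: blinfun.diff_right)
    show "ereal (l (z - z0) + a) \<le> f z"
      by (rule ereal_le_real) (use * in auto)
  qed
qed

section \<open>The pairing and its polar form\<close>

definition pairing :: "'a::real_normed_vector \<times> 'a dual \<Rightarrow> real" where
  "pairing z = blinfun_apply (snd z) (fst z)"

text \<open>The polar form \<open>pairing (w + z) - pairing w - pairing z\<close>. It turns
  \<open>z\<close> into a functional on the product, and \<open>\<J> h\<close> is the conjugate of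
  \<open>h\<close> with respect to it.\<close>

definition coupling :: "'a::real_normed_vector \<times> 'a dual \<Rightarrow> 'a \<times> 'a dual \<Rightarrow> real" where
  "coupling w z = blinfun_apply (snd z) (fst w) + blinfun_apply (snd w) (fst z)"

lemma coupling_commute: "coupling w z = coupling z w"
  by (simp add: coupling_def)

lemma bounded_linear_coupling: "bounded_linear (\<lambda>w. coupling w z)"
proof -
  have "bounded_linear (\<lambda>w. blinfun_apply (snd z) (fst w))"
    by (rule bounded_linear_compose[OF blinfun.bounded_linear_right bounded_linear_fst])
  moreover have "bounded_linear (\<lambda>w. blinfun_apply (snd w) (fst z))"
    by (rule bounded_linear_compose[OF blinfun.bounded_linear_left bounded_linear_snd])
  ultimately show ?thesis unfolding coupling_def by (rule bounded_linear_add)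
qed

lemmas coupling_add = linear_add[OF bounded_linear.linear[OF bounded_linear_coupling]]
  and coupling_scaleR = linear_scale[OF bounded_linear.linear[OF bounded_linear_coupling]]
  and coupling_minus = linear_neg[OF bounded_linear.linear[OF bounded_linear_coupling]]
  and coupling_diff = linear_diff[OF bounded_linear.linear[OF bounded_linear_coupling]]

lemma pairing_convex_combination:
  "pairing ((1 - t) *\<^sub>R z + t *\<^sub>R w)
    = (1 - t)\<^sup>2 * pairing z + t * (1 - t) * coupling w z + t\<^sup>2 * pairing w"
  by (simp add: pairing_def coupling_def blinfun.bilinear_simps algebra_simps power2_eq_square)

lemma pairing_diff: "pairing (w - z) = pairing w + pairing z - coupling w z"
  by (simp add: pairing_def coupling_def blinfun.bilinear_simps algebra_simps)

lemma coupling_self: "coupling z z = 2 * pairing z"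
  by (simp add: pairing_def coupling_def)

lemma norm_prod_square: "(norm z)\<^sup>2 = (norm (fst z))\<^sup>2 + (norm (snd z))\<^sup>2"
  by (simp add: norm_prod_def)

text \<open>Young's inequality for the Euclidean product norm.\<close>

lemma abs_pairing_le: "\<bar>pairing z\<bar> \<le> (norm z)\<^sup>2 / 2"
proof -
  have "\<bar>pairing z\<bar> \<le> norm (snd z) * norm (fst z)"
    using norm_blinfun[of "snd z" "fst z"] by (simp add: pairing_def)
  also have "\<dots> \<le> (norm z)\<^sup>2 / 2"
    using sum_squares_bound[of "norm (snd z)" "norm (fst z)"] by (simp add: norm_prod_square)
  finally show ?thesis .
qed

text \<open>The witness is \<open>(x, - u)\<close> for \<open>e = (x, v)\<close>, where \<open>u\<close> is a value of the duality mapping at \<open>x\<close>.\<close>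

lemma coupling_square_le_pairing: "\<exists>d. coupling d e + (norm d)\<^sup>2 / 2 \<le> pairing e"
proof -
  obtain l :: "'a dual" where l: "norm l \<le> 1" "l (fst e) = norm (fst e)"
    by (rule norming_functional)
  define d where "d = (fst e, - norm (fst e) *\<^sub>R l)"
  have "norm (snd d) \<le> norm (fst e)"
    using mult_left_mono[OF l(1), of "norm (fst e)"] by (simp add: d_def)
  then have "(norm d)\<^sup>2 \<le> 2 * (norm (fst e))\<^sup>2"
    using power_mono[of "norm (snd d)" "norm (fst e)" 2] by (simp add: norm_prod_square) (simp add: d_def)
  moreover have "coupling d e = pairing e - (norm (fst e))\<^sup>2"
    by (simp add: coupling_def pairing_def d_def l(2) blinfun.bilinear_simps power2_eq_square)
  ultimately show ?thesis by (intro exI[of _ d]) simp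
qed

lemma monotone_operator_pairing:
  "monotone_operator T \<longleftrightarrow> (\<forall>z\<in>T. \<forall>w\<in>T. 0 \<le> pairing (w - z))"
  by (fastforce simp: monotone_operator_def pairing_def)

lemma representing_functions_pairing:
  "\<H> T = {g. ereal_convex g \<and> lower_semicontinuous g \<and>
    (\<forall>z. ereal (pairing z) \<le> g z) \<and> (\<forall>z\<in>T. g z = ereal (pairing z))}"
  by (auto simp: representing_functions_def pairing_def)

section \<open>Conjugation on the product space\<close>

lemma conjugate_swap_coupling:
  "\<J> h z = (SUP w. ereal (coupling w z) - h w)"
  by (simp add: conjugate_swap_def conjugate_def coupling_def case_prod_beta)

text \<open>Reduces a bound on \<open>\<J> h\<close> to real inequalities over the epigraph of
  \<open>h\<close>, the form in which duality delivers them.\<close>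

lemma conjugate_swap_le_iff:
  assumes "\<And>w. h w \<noteq> -\<infinity>"
  shows "\<J> h z \<le> ereal r \<longleftrightarrow> (\<forall>w s. h w \<le> ereal s \<longrightarrow> coupling w z - s \<le> r)"
proof -
  have "ereal c - h w \<le> ereal r \<longleftrightarrow> (\<forall>s. h w \<le> ereal s \<longrightarrow> c - s \<le> r)" for c w
    using assms[of w] by (cases "h w") (auto intro: order_trans[OF diff_left_mono])
  then show ?thesis by (simp add: conjugate_swap_coupling SUP_le_iff)
qed

text \<open>The epigraph of \<open>\<J> h\<close> is an intersection of half-spaces.\<close>

lemma ereal_convex_conjugate_swap:
  assumes "\<And>w. h w \<noteq> -\<infinity>"
  shows "ereal_convex (\<J> h)"
proof -
  have "{(z, r). \<J> h z \<le> ereal r}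
      = (\<Inter>w. \<Inter>s\<in>{s. h w \<le> ereal s}. {(z, r). coupling w z - s \<le> r})"
    by (auto simp: conjugate_swap_le_iff[OF assms])
  moreover have "convex {(z, r). coupling w z - s \<le> r}" for w :: "'a \<times> 'a dual" and s
  proof (rule convexI)
    fix p q :: "('a \<times> 'a dual) \<times> real" and u v :: real
    assume p: "p \<in> {(z, r). coupling w z - s \<le> r}" and q: "q \<in> {(z, r). coupling w z - s \<le> r}"
      and uv: "0 \<le> u" "0 \<le> v" "u + v = 1"
    have "u * (coupling w (fst p) - s) + v * (coupling w (fst q) - s) \<le> u * snd p + v * snd q"
      using p q uv by (intro add_mono mult_left_mono) auto
    moreover have "s = u * s + v * s" using uv(3) by (simp flip: distrib_right)
    ultimately show "u *\<^sub>R p + v *\<^sub>R q \<in> {(z, r). coupling w z - s \<le> r}"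
      by (simp add: case_prod_beta coupling_commute[of w] coupling_add coupling_scaleR algebra_simps)
  qed
  ultimately show ?thesis
    unfolding ereal_convex_def by (auto intro!: convex_INT)
qed

text \<open>An index \<open>w\<close> whose term in the supremum exceeds \<open>a\<close> at
  \<open>z\<close> does so nearby, by continuity of the coupling.\<close>

lemma lower_semicontinuous_conjugate_swap:
  assumes "\<And>w. h w \<noteq> -\<infinity>"
  shows "lower_semicontinuous (\<J> h)"
  unfolding lower_semicontinuous_def
proof (intro allI impI)
  fix z a assume "a < \<J> h z"
  then obtain w where w: "a < ereal (coupling w z) - h w"
    by (auto simp: conjugate_swap_coupling less_SUP_iff)
  then obtain r where r: "h w = ereal r"
    using assms[of w] by (cases "h w") auto
  have "((\<lambda>z'. ereal (coupling w z' - r)) \<longlongrightarrow> ereal (coupling w z - r)) (nhds z)"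
    unfolding coupling_commute[of w]
    by (intro tendsto_ereal tendsto_diff bounded_linear.tendsto[OF bounded_linear_coupling] tendsto_const filterlim_ident)
  then have "\<forall>\<^sub>F z' in nhds z. a < ereal (coupling w z' - r)"
    using w r by (intro order_tendstoD(1)) auto
  then show "\<forall>\<^sub>F z' in nhds z. a < \<J> h z'"
  proof (rule eventually_mono)
    fix z' assume "a < ereal (coupling w z' - r)"
    also have "\<dots> \<le> \<J> h z'"
      unfolding conjugate_swap_coupling using r by (intro SUP_upper2[of w]) auto
    finally show "a < \<J> h z'" .
  qed
qed

section \<open>Contact sets with the pairing\<close>

text \<open>The pairing is differentiable along segments and touches \<open>F\<close> from below at \<open>z\<close>, so its
  derivative \<open>w \<mapsto> coupling w z\<close> is a subgradient of \<open>F\<close> at \<open>z\<close>.\<close>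

lemma coupling_subgradient:
  fixes F :: "'a::real_normed_vector \<times> 'a dual \<Rightarrow> ereal"
  assumes F: "ereal_convex F" "\<And>z. ereal (pairing z) \<le> F z" and z: "F z = ereal (pairing z)"
  shows "ereal (coupling w z - pairing z) \<le> F w"
proof (rule ereal_le_real)
  fix s assume s: "F w \<le> ereal s"
  \<comment> \<open>Convexity between \<open>(z, pairing z)\<close> and \<open>(w, s)\<close>: the
    terms of order zero in \<open>t\<close> cancel and a factor \<open>t\<close> divides out, before
    \<open>t\<close> tends to 0.\<close>
  have *: "(1 - t) * (coupling w z - pairing z) + t * pairing w \<le> s" if t: "0 < t" "t < 1" for t
  proof -
    have "F ((1 - t) *\<^sub>R z + t *\<^sub>R w) \<le> ereal ((1 - t) * pairing z + t * s)"
      using convexD_alt[OF F(1)[unfolded ereal_convex_def], of "(z, pairing z)" "(w, s)" t] z s t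
      by auto
    then have "pairing ((1 - t) *\<^sub>R z + t *\<^sub>R w) \<le> (1 - t) * pairing z + t * s"
      using order_trans[OF F(2)] by (metis ereal_less_eq(3))
    then have "t * ((1 - t) * (coupling w z - pairing z) + t * pairing w) \<le> t * s"
      unfolding pairing_convex_combination by (simp add: algebra_simps power2_eq_square)
    then show ?thesis using t by simp
  qed
  have "((\<lambda>t. (1 - t) * (coupling w z - pairing z) + t * pairing w)
      \<longlongrightarrow> (1 - 0) * (coupling w z - pairing z) + 0 * pairing w) (at_right 0)"
    by (intro tendsto_intros)
  then have "(1 - 0) * (coupling w z - pairing z) + 0 * pairing w \<le> s"
    by (rule tendsto_upperbound)
      (use * in \<open>auto simp: eventually_at_right_field intro!: exI[of _ 1]\<close>)
  then show "ereal (coupling w z - pairing z) \<le> ereal s" by simp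
qed

text \<open>At two contact points the subgradient inequality reads
  \<open>coupling w z \<le> pairing w + pairing z\<close>.\<close>

lemma contact_set_monotone:
  fixes F :: "'a::real_normed_vector \<times> 'a dual \<Rightarrow> ereal"
  assumes "ereal_convex F" "\<And>z. ereal (pairing z) \<le> F z"
  shows "monotone_operator {z. F z = ereal (pairing z)}"
  unfolding monotone_operator_pairing
proof clarify
  fix z w assume "F z = ereal (pairing z)" "F w = ereal (pairing w)"
  then show "0 \<le> pairing (w - z)"
    using coupling_subgradient[OF assms, of z w] by (simp add: pairing_diff)
qed

text \<open>The subgradient inequality at \<open>z\<close>, taken over all \<open>w\<close>, bounds
  every term of the supremum \<open>\<J> h z\<close> by \<open>pairing z\<close>.\<close>

lemma conjugate_swap_eq_pairing:
  assumes h: "ereal_convex h" "\<And>z. ereal (pairing z) \<le> h z" "\<And>z. ereal (pairing z) \<le> \<J> h z"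
    and z: "h z = ereal (pairing z)"
  shows "\<J> h z = ereal (pairing z)"
proof (rule antisym[OF _ h(3)])
  have "h w \<noteq> -\<infinity>" for w using h(2)[of w] by auto
  moreover have "coupling w z - s \<le> pairing z" if "h w \<le> ereal s" for w s
    using order_trans[OF coupling_subgradient[OF h(1,2) z] that] by simp
  ultimately show "\<J> h z \<le> ereal (pairing z)" by (simp add: conjugate_swap_le_iff)
qed

section \<open>Reflexivity and nondegeneracy of the coupling\<close>

text \<open>The restriction of \<open>l\<close> to the first factor lies in the dual; its
  restriction to the second lies in the bidual, where reflexivity supplies a point.\<close>

lemma reflexive_product_functional:
  fixes l :: "('a::real_normed_vector \<times> 'a dual) \<Rightarrow>\<^sub>L real"
  assumes "reflexive_space TYPE('a)"
  obtains z where "\<And>w. l w = coupling w z"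
proof -
  define v where "v = l o\<^sub>L Blinfun (\<lambda>y. (y, 0))"
  define \<xi> where "\<xi> = l o\<^sub>L Blinfun (\<lambda>u. (0, u))"
  have v: "v y = l (y, 0)" for y
    unfolding v_def by (simp add: bounded_linear_Blinfun_apply bounded_linear_Pair bounded_linear_ident)
  have \<xi>: "\<xi> u = l (0, u)" for u
    unfolding \<xi>_def by (simp add: bounded_linear_Blinfun_apply bounded_linear_Pair bounded_linear_ident)
  obtain x where x: "\<xi> = bidual_embedding x"
    using assms unfolding reflexive_space_def by (metis surjD)
  have "l w = coupling w (x, v)" for w
  proof -
    have "l w = l (fst w, 0) + l (0, snd w)" by (simp flip: blinfun.add_right)
    also have "\<dots> = v (fst w) + \<xi> (snd w)" by (simp add: v \<xi>)
    finally show ?thesis by (simp add: x coupling_def)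
  qed
  then show thesis by (rule that)
qed

text \<open>Replacing \<open>d\<close> by \<open>t *\<^sub>R d\<close>, dividing by \<open>t\<close>
  and letting \<open>t\<close> tend to 0 removes the quadratic term; with \<open>- d\<close> the
  coupling vanishes, and it is nondegenerate.\<close>

lemma eq_0_if_coupling_nonneg:
  assumes nonneg: "\<And>d. 0 \<le> coupling d e + (norm d)\<^sup>2 / 2"
  shows "e = 0"
proof -
  have ge: "0 \<le> coupling d e" for d
  proof -
    have "0 \<le> coupling d e + t * ((norm d)\<^sup>2 / 2)" if t: "0 < t" for t
    proof -
      have "0 \<le> t * (coupling d e + t * ((norm d)\<^sup>2 / 2))"
        using nonneg[of "t *\<^sub>R d"] by (simp add: coupling_scaleR power_mult_distrib algebra_simps power2_eq_square)
      then show ?thesis using t by (simp add: zero_le_mult_iff)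
    qed
    moreover have "((\<lambda>t. coupling d e + t * ((norm d)\<^sup>2 / 2)) \<longlongrightarrow> coupling d e + 0 * ((norm d)\<^sup>2 / 2)) (at_right 0)"
      by (intro tendsto_intros)
    ultimately have "0 \<le> coupling d e + 0 * ((norm d)\<^sup>2 / 2)"
      by (intro tendsto_lowerbound) (auto simp: eventually_at_right_field intro!: exI[of _ 1])
    then show ?thesis by simp
  qed
  have eq: "coupling d e = 0" for d
    using ge[of d] ge[of "- d"] by (simp add: coupling_minus)
  have "blinfun_apply (snd e) y = 0" for y
    using eq[of "(y, 0)"] by (simp add: coupling_def)
  then have "snd e = 0" by (intro blinfun_eqI) simp
  moreover have "fst e = 0"
    by (rule dual_separates_points) (use eq[of "(0, _)"] in \<open>simp add: coupling_def\<close>)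
  ultimately show ?thesis by (simp add: prod_eq_iff)
qed


theorem theorem3p1:
  fixes h :: "'a::banach \<times> 'a dual \<Rightarrow> ereal"
    and T :: "('a \<times> 'a dual) set"
  assumes "reflexive_space TYPE('a)"
    and "ereal_convex h"
    and "lower_semicontinuous h"
    and "\<forall>x v. h (x, v) \<ge> ereal (blinfun_apply v x)
            \<and> conjugate h (v, bidual_embedding x) \<ge> ereal (blinfun_apply v x)"
    and "T = {(x, v). h (x, v) = ereal (blinfun_apply v x)}"
  shows "maximal_monotone T \<and> h \<in> \<H> T \<and> \<J> h \<in> \<H> T"
proof -
  have h_ge: "ereal (pairing z) \<le> h z" and Jh_ge: "ereal (pairing z) \<le> \<J> h z" for z
    using assms(4) by (cases z; simp add: pairing_def conjugate_swap_def)+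
  have T: "T = {z. h z = ereal (pairing z)}"
    using assms(5) by (auto simp: pairing_def)
  have h_MInf: "h z \<noteq> -\<infinity>" for z
    using h_ge[of z] by auto
  have epi_convex: "convex {(z, r). h z \<le> ereal r}"
    using assms(2) by (simp add: ereal_convex_def)
  \<comment> \<open>If \<open>h\<close> were identically infinite, \<open>\<J> h\<close> would be
    identically minus infinity, against its lower bound at 0.\<close>
  have epi_nonempty: "\<exists>w r. h w \<le> ereal r"
  proof (rule ccontr)
    assume "\<not> ?thesis"
    then have "\<J> h 0 \<le> ereal (- 1)" by (simp add: conjugate_swap_le_iff[OF h_MInf])
    then have "ereal (pairing (0 :: 'a \<times> 'a dual)) \<le> ereal (- 1)" using Jh_ge order_trans by blast
    then show False by (simp add: pairing_def)
  qed
  then obtain y0 where y0: "h y0 < \<infinity>"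
    by (metis ereal_less_PInfty less_PInf_Ex_of_nat less_ereal.simps(4) order_le_less_trans)
  \<comment> \<open>Duality for \<open>h\<close>, translated so that \<open>z0\<close> becomes the origin, against half the squared norm.\<close>
  have approx_contact: "\<exists>z1. \<forall>d. \<J> h z1
      \<le> ereal (coupling z1 z0 - pairing z0 + coupling d (z1 - z0) + (norm d)\<^sup>2 / 2)" for z0
  proof -
    \<comment> \<open>The last bracket equals \<open>pairing (w - z0) - pairing w\<close>, so
      \<open>h + g\<close> is the sum of \<open>h - pairing\<close> and
      \<open>pairing (w - z0)\<close> plus half the squared distance, both nonnegative.\<close>
    define g where "g w = (1/2) * (dist z0 w)\<^sup>2 + (pairing z0 - coupling w z0)" for w
    obtain K where K: "\<And>w. norm (coupling w z0) \<le> norm w * K"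
      using bounded_linear.bounded[OF bounded_linear_coupling] by blast
    obtain l :: "('a \<times> 'a dual) \<Rightarrow>\<^sub>L real"
      where l: "\<And>y r w. (y, r) \<in> {(z, r). h z \<le> ereal r} \<Longrightarrow> l y - r \<le> l w + g w"
    proof (rule convex_duality[OF epi_convex])
      show "{(z, r). h z \<le> ereal r} \<noteq> {}" using epi_nonempty by auto
      have "convex_on UNIV (\<lambda>w. pairing z0 - coupling w z0)"
        by (rule convex_onI) (simp_all add: coupling_add coupling_diff coupling_scaleR algebra_simps)
      then show "convex_on UNIV g"
        unfolding g_def by (intro convex_on_add convex_on_cmul convex_on_square_dist) auto
      show "0 \<le> r + g y" if "(y, r) \<in> {(z, r). h z \<le> ereal r}" for y r
      proof -
        have "pairing y \<le> r" using that h_ge[of y] order_trans by force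
        moreover have "- pairing (y - z0) \<le> (1/2) * (dist z0 y)\<^sup>2"
          using abs_pairing_le[of "y - z0"] by (simp add: dist_norm norm_minus_commute)
        ultimately show ?thesis by (simp add: g_def pairing_diff)
      qed
      show "g w \<le> (norm z0 + 1)\<^sup>2 + (pairing z0 + \<bar>K\<bar>)" if w: "norm w \<le> 1" for w
      proof -
        have "dist z0 w \<le> norm z0 + 1"
          using norm_triangle_ineq4[of z0 w] w by (simp add: dist_norm)
        then have "(dist z0 w)\<^sup>2 \<le> (norm z0 + 1)\<^sup>2" by (rule power_mono) simp
        moreover have "norm w * K \<le> norm w * \<bar>K\<bar>" by (intro mult_left_mono) auto
        moreover have "norm w * \<bar>K\<bar> \<le> 1 * \<bar>K\<bar>" using w by (intro mult_right_mono) auto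
        ultimately show ?thesis
          unfolding g_def using K[of w] zero_le_power2[of "dist z0 w"] unfolding real_norm_def by linarith
      qed
    qed blast
    obtain z1 where z1: "\<And>w. l w = coupling w z1"
      using reflexive_product_functional[OF assms(1)] by blast
    have "coupling w z1 - s \<le> coupling z1 z0 - pairing z0 + coupling d (z1 - z0) + (norm d)\<^sup>2 / 2"
      if "h w \<le> ereal s" for w s d
    proof -
      have "coupling w z1 - s \<le> coupling (z0 + d) z1 + g (z0 + d)"
        using l[of w s "z0 + d"] that by (simp add: z1)
      also have "\<dots> = coupling z1 z0 - pairing z0 + coupling d (z1 - z0) + (norm d)\<^sup>2 / 2"
      proof -
        have "coupling (z0 + d) z1 = coupling z1 z0 + coupling d z1"
          by (simp add: coupling_add coupling_commute[of z0 z1])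
        moreover have "g (z0 + d) = (norm d)\<^sup>2 / 2 - pairing z0 - coupling d z0"
          by (simp add: g_def dist_norm coupling_add coupling_self)
        moreover have "coupling d (z1 - z0) = coupling d z1 - coupling d z0"
          by (simp add: coupling_commute[of d] coupling_diff)
        ultimately show ?thesis by simp
      qed
      finally show ?thesis .
    qed
    then show ?thesis unfolding conjugate_swap_le_iff[OF h_MInf] by blast
  qed
  \<comment> \<open>An affine minorant of \<open>h\<close> with value \<open>a > pairing z\<close>
    at \<open>z\<close> and slope \<open>y\<close> would make \<open>\<J> h y\<close> smaller than
    the subgradient inequality for \<open>\<J> h\<close> at \<open>z\<close> allows.\<close>
  have Jh_contact: "z \<in> T" if z: "\<J> h z = ereal (pairing z)" for z
  proof (rule ccontr)
    assume "z \<notin> T"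
    then have "ereal (pairing z) < h z" using h_ge[of z] by (simp add: T)
    then obtain a where a: "pairing z < a" "ereal a < h z"
      using ereal_dense2 by (metis less_ereal.simps(1))
    \<comment> \<open>A point where \<open>\<J> h\<close> has a real upper bound is the slope of a
      continuous affine minorant of \<open>h\<close>.\<close>
    obtain z1 c where c: "\<J> h z1 \<le> ereal c"
      using approx_contact[of 0] by blast
    have minorant: "ereal (Blinfun (\<lambda>w. coupling w z1) w + - c) \<le> h w" for w
    proof (rule ereal_le_real)
      fix s assume "h w \<le> ereal s"
      then have "coupling w z1 - s \<le> c"
        using c unfolding conjugate_swap_le_iff[OF h_MInf] by blast
      then show "ereal (Blinfun (\<lambda>w. coupling w z1) w + - c) \<le> ereal s"
        by (simp add: bounded_linear_Blinfun_apply[OF bounded_linear_coupling])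
    qed
    obtain l :: "('a \<times> 'a dual) \<Rightarrow>\<^sub>L real" where l: "\<And>w. ereal (l (w - z) + a) \<le> h w"
      using fenchel_moreau[OF assms(2,3) y0 minorant a(2)] by blast
    obtain y where y: "\<And>w. l w = coupling w y"
      using reflexive_product_functional[OF assms(1)] by blast
    have "coupling w y - s \<le> coupling z y - a" if "h w \<le> ereal s" for w s
      using order_trans[OF l that] by (simp add: y coupling_diff)
    then have "\<J> h y \<le> ereal (coupling z y - a)"
      by (simp add: conjugate_swap_le_iff[OF h_MInf])
    moreover have "ereal (coupling y z - pairing z) \<le> \<J> h y"
      by (rule coupling_subgradient[OF ereal_convex_conjugate_swap[OF h_MInf] Jh_ge z])
    ultimately have "ereal (coupling y z - pairing z) \<le> ereal (coupling z y - a)"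
      by (rule order_trans[rotated])
    then show False using a(1) by (simp add: coupling_commute)
  qed
  have mono: "monotone_operator T"
    unfolding T by (rule contact_set_monotone[OF assms(2) h_ge])
  have "T' \<subseteq> T" if T': "monotone_operator T'" "T \<subseteq> T'" for T'
  proof
    fix z0 assume z0: "z0 \<in> T'"
    obtain z1 where z1: "\<And>d. \<J> h z1
        \<le> ereal (coupling z1 z0 - pairing z0 + coupling d (z1 - z0) + (norm d)\<^sup>2 / 2)"
      using approx_contact by blast
    have le: "pairing (z1 - z0) \<le> coupling d (z1 - z0) + (norm d)\<^sup>2 / 2" for d
      using order_trans[OF Jh_ge z1, of d] by (simp add: pairing_diff)
    \<comment> \<open>For this \<open>d\<close> the bound on \<open>\<J> h z1\<close> collapses to
      \<open>pairing z1\<close>, which puts \<open>z1\<close> in the contact set.\<close>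
    obtain d where "coupling d (z1 - z0) + (norm d)\<^sup>2 / 2 \<le> pairing (z1 - z0)"
      using coupling_square_le_pairing by blast
    then have "\<J> h z1 \<le> ereal (pairing z1)"
      by (intro order_trans[OF z1[of d]]) (simp add: pairing_diff)
    then have "z1 \<in> T"
      using Jh_ge by (intro Jh_contact antisym)
    then have "z1 \<in> T'" using T'(2) by (rule rev_subsetD)
    then have "0 \<le> pairing (z1 - z0)"
      using T'(1) z0 by (simp add: monotone_operator_pairing)
    \<comment> \<open>Monotonicity makes the left side of \<open>le\<close> nonnegative, so its
      right side is nonnegative for every \<open>d\<close>.\<close>
    then have "z1 - z0 = 0"
      by (intro eq_0_if_coupling_nonneg order_trans[OF _ le])
    then show "z0 \<in> T" using \<open>z1 \<in> T\<close> by simp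
  qed
  with mono have "maximal_monotone T"
    by (auto simp: maximal_monotone_def)
  moreover have "h \<in> \<H> T"
    using assms(2,3) h_ge by (simp add: representing_functions_pairing T)
  moreover have "\<J> h \<in> \<H> T"
    using ereal_convex_conjugate_swap[of h, OF h_MInf]
      lower_semicontinuous_conjugate_swap[of h, OF h_MInf] Jh_ge conjugate_swap_eq_pairing[OF assms(2) h_ge Jh_ge]
    by (simp add: representing_functions_pairing T)
  ultimately show ?thesis by blast
qed

end
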